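(* Let $\mathbf H$ be a Heyting algebra. The embedding $\iota\colon \mathbf H\to \mathrm{D}(\mathbf H)$, $\iota(w)=(w,w,w)$, has a right adjoint $f\colon \mathrm{D}(\mathbf H)\to\mathbf H$ given by $f(a,u,x)=u\wedge(x\rightarrow a)$.
   Context: For a Heyting algebra $\mathbf H$ (with order $\le$, meet $\wedge$, top $1$ and implication $\rightarrow$), $\mathrm{D}(\mathbf H)$ is the preorder whose elements are triples $(a,u,x)$ of elements of $\mathbf H$ with $a\le u\wedge x$, with $(a,u,x)\le(b,v,y)$ iff $u\le v$, $u\wedge y\le x$, and $a\wedge(u\wedge y)\le b\wedge(u\wedge y)$. Preorders are regarded as categories with at most one morphism between any two objects, and adjoints are adjoints between monotone maps. *)

theory Defs
  imports Main "HOL-Library.FuncSet"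
begin

class heyting_algebra = bounded_lattice +
  fixes himp :: "'a \<Rightarrow> 'a \<Rightarrow> 'a"  (infixr \<open>\<rightarrow>\<^sub>H\<close> 60)
  assumes inf_le_iff_le_himp: "inf w x \<le> a \<longleftrightarrow> w \<le> (x \<rightarrow>\<^sub>H a)"

definition D_carrier :: "('a::heyting_algebra \<times> 'a \<times> 'a) set" where
  "D_carrier = {(a, u, x). a \<le> inf u x}"

fun D_le :: "'a::heyting_algebra \<times> 'a \<times> 'a \<Rightarrow> 'a \<times> 'a \<times> 'a \<Rightarrow> bool" where
  "D_le (a, u, x) (b, v, y) \<longleftrightarrow>
     u \<le> v \<and> inf u y \<le> x \<and> inf a (inf u y) \<le> inf b (inf u y)"

definition D_embed :: "'a::heyting_algebra \<Rightarrow> 'a \<times> 'a \<times> 'a" where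
  "D_embed w = (w, w, w)"

fun D_coreflect :: "'a::heyting_algebra \<times> 'a \<times> 'a \<Rightarrow> 'a" where
  "D_coreflect (a, u, x) = inf u (x \<rightarrow>\<^sub>H a)"

definition preordered :: "'a set \<Rightarrow> ('a \<Rightarrow> 'a \<Rightarrow> bool) \<Rightarrow> bool" where
  "preordered A le \<longleftrightarrow> reflp_on A le \<and> transp_on A le"

text \<open>
  As functors between thin categories, these are the full and faithful functors
  that are injective on objects. Injectivity is required separately, since a
  preorder need not be antisymmetric.
\<close>
definition preorder_embedding ::
  "'a set \<Rightarrow> ('a \<Rightarrow> 'a \<Rightarrow> bool) \<Rightarrow> 'b set \<Rightarrow> ('b \<Rightarrow> 'b \<Rightarrow> bool) \<Rightarrow> ('a \<Rightarrow> 'b) \<Rightarrow> bool" where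
  "preorder_embedding A leA B leB l \<longleftrightarrow>
     preordered A leA \<and> preordered B leB \<and> l \<in> A \<rightarrow> B \<and> inj_on l A \<and>
     (\<forall>x\<in>A. \<forall>y\<in>A. leB (l x) (l y) \<longleftrightarrow> leA x y)"

text \<open>
  \<open>r : B \<rightarrow> A\<close> is right adjoint to \<open>l : A \<rightarrow> B\<close>. The hom-sets of a preorder have at
  most one element, so the natural bijection between \<open>Hom (l x) y\<close> and \<open>Hom x (r y)\<close>
  amounts to the equivalence below. \<open>HOL-Algebra.Galois_Connection\<close> does not apply,
  because it requires partial orders on both sides.
\<close>
definition preorder_right_adjoint ::
  "'a set \<Rightarrow> ('a \<Rightarrow> 'a \<Rightarrow> bool) \<Rightarrow> 'b set \<Rightarrow> ('b \<Rightarrow> 'b \<Rightarrow> bool) \<Rightarrow> ('a \<Rightarrow> 'b) \<Rightarrow> ('b \<Rightarrow> 'a) \<Rightarrow> bool" where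
  "preorder_right_adjoint A leA B leB l r \<longleftrightarrow>
     preordered A leA \<and> preordered B leB \<and>
     l \<in> A \<rightarrow> B \<and> monotone_on A leA leB l \<and>
     r \<in> B \<rightarrow> A \<and> monotone_on B leB leA r \<and>
     (\<forall>x\<in>A. \<forall>y\<in>B. leB (l x) y \<longleftrightarrow> leA x (r y))"

end

theory Submission
  imports Defs
begin

text \<open>
  Comparing \<open>(w, w, w)\<close> with \<open>(a, u, x)\<close> makes the second defining condition trivial and
  reduces the third to \<open>inf w x \<le> a\<close>, which by residuation is \<open>w \<le> (x \<rightarrow>\<^sub>H a)\<close>. Together with
  the first condition \<open>w \<le> u\<close> this is exactly \<open>w \<le> inf u (x \<rightarrow>\<^sub>H a)\<close>, so the hom-set
  equivalence of the adjunction holds (\<open>D_embed_le_iff\<close>). Everything else is formal once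
  \<open>D_le\<close> is known to be transitive: the coreflector is monotone because
  the counit \<open>D_le (D_embed (D_coreflect p)) p\<close> can be composed with any \<open>D_le p q\<close>, and the
  embedding reflects and preserves the order because the unit \<open>w \<le> D_coreflect (D_embed w)\<close>
  is an equality.
\<close>

text \<open>
  The point is that \<open>inf u z \<le> inf u y\<close>: the context \<open>inf u z\<close> of the composite is
  contained in the context \<open>inf u y\<close> of the first comparison, and, as \<open>u \<le> v\<close>, in the context
  \<open>inf v z\<close> of the second one. Both comparisons can thus be restricted to it and chained.
\<close>
lemma D_le_trans:
  assumes "D_le p q" and "D_le q r"
  shows "D_le p r"
proof -
  obtain a u x b v y c w z where pqr: "p = (a, u, x)" "q = (b, v, y)" "r = (c, w, z)"
    by (metis prod_cases3)
  have uv: "u \<le> v" and ux: "inf u y \<le> x" and ab: "inf a (inf u y) \<le> b"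
    using assms(1) by (auto simp: pqr)
  have vw: "v \<le> w" and vy: "inf v z \<le> y" and bc: "inf b (inf v z) \<le> c"
    using assms(2) by (auto simp: pqr)
  have uz_vz: "inf u z \<le> inf v z"
    using uv by (rule inf_mono) simp
  have uz_uy: "inf u z \<le> inf u y"
    using uz_vz vy by (meson inf_le1 le_inf_iff order_trans)
  have "inf a (inf u z) \<le> inf b (inf v z)"
    using uz_uy uz_vz ab by (meson inf_le2 inf_mono le_inf_iff order_refl order_trans)
  then have "inf a (inf u z) \<le> c"
    using bc by (rule order_trans)
  moreover have "inf u z \<le> x"
    using uz_uy ux by (rule order_trans)
  moreover have "u \<le> w"
    using uv vw by (rule order_trans)
  ultimately show ?thesis
    by (simp add: pqr le_infI1 le_infI2)
qed

lemma preordered_D: "preordered D_carrier D_le"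
  unfolding preordered_def
proof
  show "reflp_on D_carrier D_le"
    by (auto simp: reflp_on_def D_carrier_def)
  show "transp_on D_carrier D_le"
    by (blast intro: transp_onI D_le_trans)
qed

lemma D_embed_le_iff: "D_le (D_embed w) p \<longleftrightarrow> w \<le> D_coreflect p"
proof -
  obtain a u x where p: "p = (a, u, x)"
    by (metis prod_cases3)
  have "D_le (D_embed w) p \<longleftrightarrow> w \<le> u \<and> inf w x \<le> a"
    by (simp add: p D_embed_def)
  then show ?thesis
    by (simp add: p inf_le_iff_le_himp)
qed

lemma D_coreflect_embed: "D_coreflect (D_embed w) = w"
proof -
  have "w \<le> (w \<rightarrow>\<^sub>H w)"
    by (simp flip: inf_le_iff_le_himp)
  then show ?thesis
    by (simp add: D_embed_def inf_absorb1)
qed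

lemma D_coreflect_mono:
  assumes "D_le p q"
  shows "D_coreflect p \<le> D_coreflect q"
proof -
  have "D_le (D_embed (D_coreflect p)) p"
    by (simp add: D_embed_le_iff)
  then have "D_le (D_embed (D_coreflect p)) q"
    using assms by (rule D_le_trans)
  then show ?thesis
    by (simp add: D_embed_le_iff)
qed

theorem proposition7:
  shows "preorder_embedding (UNIV :: 'a::heyting_algebra set) (\<le>) D_carrier D_le D_embed
    \<and> preorder_right_adjoint (UNIV :: 'a set) (\<le>) D_carrier D_le D_embed D_coreflect"
proof -
  have H: "preordered (UNIV :: 'a set) (\<le>)"
    by (simp add: preordered_def)
  have into: "D_embed \<in> (UNIV :: 'a set) \<rightarrow> D_carrier"
    by (simp add: D_embed_def D_carrier_def)
  have inj: "inj (D_embed :: 'a \<Rightarrow> _)"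
    by (rule inj_on_inverseI) (rule D_coreflect_embed)
  show ?thesis
    using H into inj
    by (simp add: preorder_embedding_def preorder_right_adjoint_def preordered_D
        monotone_on_def D_embed_le_iff D_coreflect_embed D_coreflect_mono)
qed

end
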